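(* Let $k\ge 2$ and let $A_0A_1\ldots A_k$ be a (non-degenerate) $k$-simplex in $\mathbb{R}^n$ with integer vertices, all of whose edges have integer length $1$. Let $$\alpha=\angle(A_0;A_1,A_2,\ldots,A_k),\qquad \beta=\angle(A_1;A_0,A_2,\ldots,A_k),$$ and assume that $\alpha$ and $\beta$ are simple. Then $$\operatorname{lsin}_k\beta=\operatorname{lsin}_k\alpha,$$ $$\operatorname{lcos}_{1,k}\beta+\sum_{i=1}^{k-1}\operatorname{lcos}_{i,k}\alpha\equiv 1\pmod{\operatorname{lsin}_k\alpha},$$ $$\operatorname{lcos}_{x,k}\beta=\operatorname{lcos}_{x,k}\alpha\quad\text{for } x\in\{2,\ldots,k-1\}.$$
   Context: The integer length of a segment $AB$ with integer endpoints is the index of $\mathbb{Z}\cdot\overrightarrow{AB}$ in the group of integer vectors parallel to $AB$ (so it is $1$ iff $\overrightarrow{AB}$ is primitive). For integer points $B_0,B_1,\ldots,B_k$ with $\overrightarrow{B_0B_i}$ linearly independent, $\angle(B_0;B_1,\ldots,B_k)$ is the ordered rational $k$-cone with vertex $B_0$ whose $i$-th edge is the ray from $B_0$ through $B_i$. For an ordered rational $k$-cone $\alpha$ in $\mathbb{R}^n$ let $v_1,\ldots,v_k$ be the primitive integer vectors along its edges, in order, and let $\Gamma=\mathbb{Z}^n\cap\operatorname{span}_{\mathbb{R}}(v_1,\ldots,v_k)$. There is a unique $\mathbb{Z}$-basis $e_1,\ldots,e_k$ of $\Gamma$ such that $v_i=\sum_{j\le i}a_{j,i}e_j$ with $a_{i,i}>0$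 and $0\le a_{j,i}<a_{i,i}$ for $j<i$. The $i$-th integer sine is $\operatorname{lsin}_i\alpha=a_{i,i}$ and the $(j,i)$-th integer cosine ($j<i$) is $\operatorname{lcos}_{j,i}\alpha=a_{j,i}$. The integer sine of a rational $m$-cone $\gamma$ with primitive edge vectors $w_1,\ldots,w_m$ is the index $\operatorname{lsin}(\gamma)=[\mathbb{Z}^n\cap\operatorname{span}_{\mathbb{R}}(w_1,\ldots,w_m):\mathbb{Z}w_1+\cdots+\mathbb{Z}w_m]$. A rational $k$-cone is simple if every one of its $(k-1)$-dimensional faces (cones with the same vertex generated by $k-1$ of its edges) has integer sine $1$. *)

theory Defs
  imports "HOL-Analysis.Analysis" "HOL-Number_Theory.Cong"
begin

definition int_vecs :: "(real ^ 'n) set" where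
  "int_vecs = {v. \<forall>i. v $ i \<in> \<int>}"

(* The number of cosets g + H with g in G; it is 0 when the index is infinite. *)
definition subgroup_index :: "'a::ab_group_add set \<Rightarrow> 'a set \<Rightarrow> nat" where
  "subgroup_index G H = card ((\<lambda>g. (+) g ` H) ` G)"

definition int_length :: "real ^ 'n \<Rightarrow> real ^ 'n \<Rightarrow> nat" where
  "int_length A B =
     subgroup_index (int_vecs \<inter> span {B - A}) (range (\<lambda>m::int. of_int m *\<^sub>R (B - A)))"

definition primitive_vec :: "real ^ 'n \<Rightarrow> bool" where
  "primitive_vec v \<longleftrightarrow> v \<in> int_vecs \<and> Gcd (range (\<lambda>i. \<lfloor>v $ i\<rfloor>)) = 1"

definition ray :: "real ^ 'n \<Rightarrow> real ^ 'n \<Rightarrow> (real ^ 'n) set" where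
  "ray B0 B = {B0 + t *\<^sub>R (B - B0) | t. 0 \<le> t}"

(* An ordered cone is given by its vertex and the list of its edges, each edge being a ray.
   The dimension k is the length of the list.  Edges and all families attached to a cone
   are numbered from 1 to k, while list positions start at 0. *)
datatype 'n ordered_cone =
  Cone (vertex: "real ^ 'n") (edges: "(real ^ 'n) set list")

definition cone_dim :: "'n::finite ordered_cone \<Rightarrow> nat" where
  "cone_dim \<alpha> = length (edges \<alpha>)"

definition angle_cone :: "real ^ 'n \<Rightarrow> (real ^ 'n) list \<Rightarrow> 'n ordered_cone" where
  "angle_cone B0 Bs = Cone B0 (map (ray B0) Bs)"

definition edge_vec :: "'n::finite ordered_cone \<Rightarrow> nat \<Rightarrow> real ^ 'n" where
  "edge_vec \<alpha> i = (THE v. primitive_vec v \<and> vertex \<alpha> + v \<in> edges \<alpha> ! (i - 1))"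

definition cone_lattice :: "'n::finite ordered_cone \<Rightarrow> (real ^ 'n) set" where
  "cone_lattice \<alpha> = int_vecs \<inter> span (edge_vec \<alpha> ` {1..cone_dim \<alpha>})"

definition int_combs :: "nat \<Rightarrow> (nat \<Rightarrow> real ^ 'n) \<Rightarrow> (real ^ 'n) set" where
  "int_combs m w = {\<Sum>i=1..m. of_int (c i) *\<^sub>R w i | c :: nat \<Rightarrow> int. True}"

definition cone_lsin :: "'n::finite ordered_cone \<Rightarrow> nat" where
  "cone_lsin \<gamma> = subgroup_index (cone_lattice \<gamma>) (int_combs (cone_dim \<gamma>) (edge_vec \<gamma>))"

definition simple_cone :: "'n::finite ordered_cone \<Rightarrow> bool" where
  "simple_cone \<alpha> \<longleftrightarrow>
     (\<forall>I \<subseteq> {..<cone_dim \<alpha>}. card I = cone_dim \<alpha> - 1 \<longrightarrow>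
        cone_lsin (Cone (vertex \<alpha>) (nths (edges \<alpha>) I)) = 1)"

definition int_basis :: "nat \<Rightarrow> (nat \<Rightarrow> real ^ 'n) \<Rightarrow> (real ^ 'n) set \<Rightarrow> bool" where
  "int_basis k e L \<longleftrightarrow>
     e ` {1..k} \<subseteq> L \<and>
     (\<forall>x\<in>L. \<exists>!c :: nat \<Rightarrow> int.
        (\<forall>i. i \<notin> {1..k} \<longrightarrow> c i = 0) \<and> x = (\<Sum>i=1..k. of_int (c i) *\<^sub>R e i))"

definition hermite_basis ::
  "'n::finite ordered_cone \<Rightarrow> (nat \<Rightarrow> real ^ 'n) \<Rightarrow> (nat \<Rightarrow> nat \<Rightarrow> int) \<Rightarrow> bool" where
  "hermite_basis \<alpha> e a \<longleftrightarrow>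
     int_basis (cone_dim \<alpha>) e (cone_lattice \<alpha>) \<and>
     (\<forall>i\<in>{1..cone_dim \<alpha>}.
        edge_vec \<alpha> i = (\<Sum>j=1..i. of_int (a j i) *\<^sub>R e j) \<and>
        0 < a i i \<and> (\<forall>j\<in>{1..<i}. 0 \<le> a j i \<and> a j i < a i i))"

(* The basis and the matrix are unique only on indices 1 \<le> j \<le> i \<le> k, so the
   description is applied to the single entry and not to the functions e and a. *)
definition hermite_entry :: "nat \<Rightarrow> nat \<Rightarrow> 'n::finite ordered_cone \<Rightarrow> int" where
  "hermite_entry j i \<alpha> = (THE c. \<exists>e a. hermite_basis \<alpha> e a \<and> c = a j i)"

definition lsin :: "nat \<Rightarrow> 'n::finite ordered_cone \<Rightarrow> int" where
  "lsin i \<alpha> = hermite_entry i i \<alpha>"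

(* Meaningful for 1 \<le> j < i \<le> k. *)
definition lcos :: "nat \<Rightarrow> nat \<Rightarrow> 'n::finite ordered_cone \<Rightarrow> int" where
  "lcos j i \<alpha> = hermite_entry j i \<alpha>"

end

theory Submission imports Defs begin

text \<open>
  Put \<open>v i = A i - A 0\<close>. Since the face of \<open>\<alpha>\<close> spanned by its first \<open>k - 1\<close> edges has integer sine 1,
  the vectors \<open>v 1, \<dots>, v (k - 1)\<close> extend by some \<open>u\<close> to a basis of the lattice of \<open>\<alpha>\<close>. If
  \<open>v k = c 1 v 1 + \<dots> + c (k - 1) v (k - 1) + s u\<close> with \<open>s > 0\<close>, then reducing the \<open>c j\<close> modulo \<open>s\<close>
  by changing \<open>u\<close> shows that \<open>s\<close> is the last sine and the residues are the last cosines of \<open>\<alpha>\<close>.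
  The cone \<open>\<beta>\<close> has the same lattice, with basis \<open>- v 1, v 2 - v 1, \<dots>, v (k - 1) - v 1, u\<close>, and the
  coordinates of its last edge \<open>v k - v 1\<close> are \<open>1 - (c 1 + \<dots> + c (k - 1)), c 2, \<dots>, c (k - 1), s\<close>.
\<close>

section \<open>Subgroups of index one, and integer vectors of bounded norm\<close>

text \<open>With a single coset, \<open>g + H\<close> coincides with \<open>0 + H = H\<close>, and
  \<open>0\<close> in \<open>H\<close> puts \<open>g\<close> into the former.\<close>

lemma subgroup_index_eq_1_imp_subset:
  assumes "subgroup_index G H = 1" and "0 \<in> G" and "0 \<in> H"
  shows "G \<subseteq> H"
proof
  fix g assume g: "g \<in> G"
  obtain C where C: "(\<lambda>g. (+) g ` H) ` G = {C}"
    using assms(1) unfolding subgroup_index_def by (rule card_1_singletonE)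
  have "(+) g ` H = C" "(+) 0 ` H = C"
    using C g assms(2) by blast+
  moreover have "g \<in> (+) g ` H"
    using assms(3) by (intro image_eqI[of _ _ 0]) auto
  ultimately show "g \<in> H" by auto
qed

lemma int_vecs_0 [simp]: "0 \<in> int_vecs"
  and int_vecs_add: "x \<in> int_vecs \<Longrightarrow> y \<in> int_vecs \<Longrightarrow> x + y \<in> int_vecs"
  and int_vecs_diff: "x \<in> int_vecs \<Longrightarrow> y \<in> int_vecs \<Longrightarrow> x - y \<in> int_vecs"
  and int_vecs_scale: "x \<in> int_vecs \<Longrightarrow> of_int m *\<^sub>R x \<in> int_vecs"
  by (auto simp: int_vecs_def)

lemma int_vecs_sum: "(\<And>i. i \<in> I \<Longrightarrow> f i \<in> int_vecs) \<Longrightarrow> sum f I \<in> int_vecs"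
  by (induction I rule: infinite_finite_induct) (auto intro: int_vecs_add)

text \<open>Serves to find a least positive value of a linear functional on a lattice. Coordinates
  are bounded by the norm, so their floors range over a finite box that determines the
  vector.\<close>

lemma finite_bounded_int_vecs: "finite {x :: real ^ 'n. x \<in> int_vecs \<and> norm x \<le> R}"
proof -
  let ?F = "PiE (UNIV :: 'n set) (\<lambda>_. {-\<lceil>R\<rceil>..\<lceil>R\<rceil>})"
  have "x \<in> (\<lambda>f. \<chi> i. of_int (f i)) ` ?F" if x: "x \<in> int_vecs" "norm x \<le> R" for x :: "real ^ 'n"
  proof (rule image_eqI[of _ _ "\<lambda>i. \<lfloor>x $ i\<rfloor>"])
    show "x = (\<chi> i. of_int \<lfloor>x $ i\<rfloor>)"
      using x(1) by (auto simp: int_vecs_def vec_eq_iff)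
    have "\<bar>x $ i\<bar> \<le> R" for i
      using component_le_norm_cart[of x i] x(2) by linarith
    then show "(\<lambda>i. \<lfloor>x $ i\<rfloor>) \<in> ?F"
      by (auto simp: abs_le_iff le_floor_iff ceiling_le_iff minus_le_iff floor_le_iff)
        (smt (verit) le_of_int_ceiling of_int_minus floor_le_iff le_floor_iff)+
  qed
  then have "{x :: real ^ 'n. x \<in> int_vecs \<and> norm x \<le> R} \<subseteq> (\<lambda>f. \<chi> i. of_int (f i)) ` ?F"
    by blast
  moreover have "finite ?F"
    by (intro finite_PiE) auto
  ultimately show ?thesis
    using finite_subset by blast
qed

section \<open>Integer length one and primitive edge vectors\<close>

text \<open>The working form of the hypothesis on edge lengths; it yields both the primitivity and
  the uniqueness of edge vectors.\<close>

lemma int_length_eq_1D: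
  assumes "int_length A B = 1" and "x \<in> int_vecs" and "x \<in> span {B - A}"
  obtains m :: int where "x = of_int m *\<^sub>R (B - A)"
proof -
  have "0 \<in> range (\<lambda>m::int. of_int m *\<^sub>R (B - A))"
    by (intro range_eqI[of _ _ 0]) simp
  then have "int_vecs \<inter> span {B - A} \<subseteq> range (\<lambda>m::int. of_int m *\<^sub>R (B - A))"
    using assms(1) unfolding int_length_def
    by (intro subgroup_index_eq_1_imp_subset) (auto simp: span_zero)
  with assms(2,3) that show thesis by blast
qed

text \<open>Dividing \<open>B - A\<close> by the gcd \<open>d\<close> of its coordinates leaves a
  parallel integer vector. Length one makes this an integer multiple of \<open>B - A\<close>, so
  \<open>1 / d\<close> is an integer and \<open>d = 1\<close>.\<close>

lemma primitive_vec_of_int_length: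
  assumes "B - A \<in> int_vecs" and "B \<noteq> A" and "int_length A B = 1"
  shows "primitive_vec (B - A)"
proof -
  define u where "u = B - A"
  define d where "d = Gcd (range (\<lambda>i. \<lfloor>u $ i\<rfloor>))"
  have u: "u $ i = of_int \<lfloor>u $ i\<rfloor>" for i
    using assms(1) by (auto simp: u_def int_vecs_def)
  have "u \<noteq> 0" using assms(2) by (simp add: u_def)
  then obtain i where "u $ i \<noteq> 0" by (auto simp: vec_eq_iff)
  then have "\<lfloor>u $ i\<rfloor> \<noteq> 0" using u[of i] by auto
  then have "d \<noteq> 0" unfolding d_def by auto
  have "u $ j / of_int d \<in> \<int>" for j
  proof -
    have "d dvd \<lfloor>u $ j\<rfloor>" unfolding d_def by (rule Gcd_dvd) auto
    then obtain q where "\<lfloor>u $ j\<rfloor> = d * q" ..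
    then have "u $ j = of_int d * of_int q" using u[of j] by simp
    then show ?thesis using \<open>d \<noteq> 0\<close> by simp
  qed
  then have "(1 / of_int d) *\<^sub>R u \<in> int_vecs"
    by (simp add: int_vecs_def)
  moreover have "(1 / of_int d) *\<^sub>R u \<in> span {B - A}"
    by (simp add: u_def span_base span_scale)
  ultimately obtain m :: int where "(1 / of_int d) *\<^sub>R u = of_int m *\<^sub>R u"
    using int_length_eq_1D[OF assms(3)] u_def by blast
  then have "1 / of_int d = (of_int m :: real)"
    using \<open>u \<noteq> 0\<close> by simp
  then have "(of_int (m * d) :: real) = of_int 1"
    using \<open>d \<noteq> 0\<close> by (simp add: field_simps)
  then have "m * d = 1" unfolding of_int_eq_iff .
  then have "d dvd 1" by (metis dvd_triv_right)
  moreover have "d \<ge> 0" by (simp add: d_def)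
  ultimately have "d = 1" by simp
  then show ?thesis
    using assms(1) by (simp add: primitive_vec_def d_def u_def)
qed

text \<open>Evaluates the description in \<open>edge_vec\<close>. A primitive vector on the ray is
  an integer multiple \<open>m\<close> of \<open>B - vertex \<gamma>\<close> by length one; then
  \<open>m\<close> divides all its coordinates, so primitivity leaves only a unit.\<close>

lemma edge_vec_eq:
  assumes "edges \<gamma> ! (i - 1) = ray (vertex \<gamma>) B"
    and "B - vertex \<gamma> \<in> int_vecs" and "B \<noteq> vertex \<gamma>" and "int_length (vertex \<gamma>) B = 1"
  shows "edge_vec \<gamma> i = B - vertex \<gamma>"
  unfolding edge_vec_def
proof (rule the_equality)
  have "vertex \<gamma> + (B - vertex \<gamma>) \<in> ray (vertex \<gamma>) B"
    unfolding ray_def by (auto intro: exI[of _ 1])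
  then show "primitive_vec (B - vertex \<gamma>) \<and> vertex \<gamma> + (B - vertex \<gamma>) \<in> edges \<gamma> ! (i - 1)"
    using primitive_vec_of_int_length[OF assms(2-4)] assms(1) by simp
next
  define u where "u = B - vertex \<gamma>"
  fix v assume v: "primitive_vec v \<and> vertex \<gamma> + v \<in> edges \<gamma> ! (i - 1)"
  then have "vertex \<gamma> + v \<in> ray (vertex \<gamma>) B" using assms(1) by metis
  then obtain t where t: "0 \<le> t" "v = t *\<^sub>R u"
    by (auto simp: ray_def u_def)
  then have "v \<in> span {B - vertex \<gamma>}"
    by (simp add: u_def span_base span_scale)
  then obtain m :: int where m: "v = of_int m *\<^sub>R u"
    using v int_length_eq_1D[OF assms(4)] unfolding primitive_vec_def u_def by metis
  have "u \<noteq> 0" using assms(3) by (simp add: u_def)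
  then have "t = of_int m" using t m by simp
  \<comment> \<open>The ray, as opposed to the line, excludes the opposite primitive vector
    \<open>m = -1\<close>.\<close>
  then have "m \<ge> 0" using t by simp
  have "m dvd \<lfloor>v $ j\<rfloor>" for j
  proof -
    have "u $ j = of_int \<lfloor>u $ j\<rfloor>"
      using assms(2) by (auto simp: u_def int_vecs_def)
    then have "v $ j = of_int (m * \<lfloor>u $ j\<rfloor>)" using m by simp
    then have "\<lfloor>v $ j\<rfloor> = m * \<lfloor>u $ j\<rfloor>" by (metis floor_of_int)
    then show ?thesis by simp
  qed
  then have "m dvd Gcd (range (\<lambda>j. \<lfloor>v $ j\<rfloor>))"
    by (intro Gcd_greatest) auto
  then have "m = 1" using v \<open>m \<ge> 0\<close> by (auto simp: primitive_vec_def)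
  then show "v = B - vertex \<gamma>" using m by (simp add: u_def)
qed

section \<open>Integer combinations and integer bases\<close>

lemma int_combsI: "(\<Sum>i=1..m. of_int (c i) *\<^sub>R w i) \<in> int_combs m w"
  unfolding int_combs_def by blast

lemma int_combs_base: "i \<in> {1..m} \<Longrightarrow> w i \<in> int_combs m w"
  using int_combsI[of "\<lambda>j. if j = i then 1 else 0" w m]
  by (simp add: if_distrib[of of_int] if_distribR if_distrib[of "\<lambda>r. r *\<^sub>R _"] cong: if_cong)

lemma int_combs_add: "x \<in> int_combs m w \<Longrightarrow> y \<in> int_combs m w \<Longrightarrow> x + y \<in> int_combs m w"
proof -
  assume "x \<in> int_combs m w" "y \<in> int_combs m w"
  then obtain c d :: "nat \<Rightarrow> int"
    where "x = (\<Sum>i=1..m. of_int (c i) *\<^sub>R w i)" "y = (\<Sum>i=1..m. of_int (d i) *\<^sub>R w i)"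
    unfolding int_combs_def by blast
  then have "x + y = (\<Sum>i=1..m. of_int (c i + d i) *\<^sub>R w i)"
    by (simp add: scaleR_add_left sum.distrib)
  then show ?thesis using int_combsI by metis
qed

lemma int_combs_scale: "x \<in> int_combs m w \<Longrightarrow> of_int q *\<^sub>R x \<in> int_combs m w"
proof -
  assume "x \<in> int_combs m w"
  then obtain c :: "nat \<Rightarrow> int" where "x = (\<Sum>i=1..m. of_int (c i) *\<^sub>R w i)"
    unfolding int_combs_def by blast
  then have "of_int q *\<^sub>R x = (\<Sum>i=1..m. of_int (q * c i) *\<^sub>R w i)"
    by (simp add: scaleR_sum_right)
  then show ?thesis using int_combsI by metis
qed

lemma int_combs_diff: "x \<in> int_combs m w \<Longrightarrow> y \<in> int_combs m w \<Longrightarrow> x - y \<in> int_combs m w"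
  using int_combs_add[of x m w "of_int (-1) *\<^sub>R y"] int_combs_scale[of y m w "-1"] by simp

lemma int_combs_0: "0 \<in> int_combs m w"
  using int_combsI[of "\<lambda>_. 0" w m] by simp

lemma int_combs_sum: "(\<And>i. i \<in> I \<Longrightarrow> f i \<in> int_combs m w) \<Longrightarrow> sum f I \<in> int_combs m w"
  by (induction I rule: infinite_finite_induct) (auto intro: int_combs_add int_combs_0)

lemma int_combs_subset:
  assumes "\<And>i. i \<in> {1..m} \<Longrightarrow> e i \<in> int_combs k f"
  shows "int_combs m e \<subseteq> int_combs k f"
proof
  fix x assume "x \<in> int_combs m e"
  then obtain c :: "nat \<Rightarrow> int" where "x = (\<Sum>i=1..m. of_int (c i) *\<^sub>R e i)"
    unfolding int_combs_def by blast
  then show "x \<in> int_combs k f"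
    using assms by (auto intro!: int_combs_sum int_combs_scale)
qed

lemma int_combs_subset_lattice:
  assumes "e ` {1..k} \<subseteq> int_vecs \<inter> span S"
  shows "int_combs k e \<subseteq> int_vecs \<inter> span S"
proof
  fix x assume "x \<in> int_combs k e"
  then obtain c :: "nat \<Rightarrow> int" where "x = (\<Sum>i=1..k. of_int (c i) *\<^sub>R e i)"
    unfolding int_combs_def by blast
  moreover have "e i \<in> int_vecs" "e i \<in> span S" if "i \<in> {1..k}" for i
    using assms that by auto
  ultimately show "x \<in> int_vecs \<inter> span S"
    by (auto intro!: int_vecs_sum int_vecs_scale span_sum span_scale)
qed

lemma int_combs_subset_span: "int_combs k e \<subseteq> span (e ` {1..k})"
proof
  fix x assume "x \<in> int_combs k e"
  then obtain c :: "nat \<Rightarrow> int" where "x = (\<Sum>i=1..k. of_int (c i) *\<^sub>R e i)"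
    unfolding int_combs_def by blast
  then show "x \<in> span (e ` {1..k})"
    by (auto intro!: span_sum span_scale intro: span_base)
qed

lemma int_basisD:
  assumes "int_basis k e L" and "x \<in> L"
    and "x = (\<Sum>i=1..k. of_int (c i) *\<^sub>R e i)" and "x = (\<Sum>i=1..k. of_int (d i) *\<^sub>R e i)"
    and "i \<in> {1..k}"
  shows "c i = d i"
proof -
  \<comment> \<open>Uniqueness in \<open>int_basis\<close> concerns coefficient functions vanishing
    outside \<open>{1..k}\<close>, so both given ones are first cut off there.\<close>
  define r where "r = (\<lambda>(c::nat \<Rightarrow> int) i. if i \<in> {1..k} then c i else 0)"
  have eq: "(\<Sum>i=1..k. of_int (r c i) *\<^sub>R e i) = (\<Sum>i=1..k. of_int (c i) *\<^sub>R e i)" for c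
    by (rule sum.cong) (auto simp: r_def)
  have "\<exists>!c :: nat \<Rightarrow> int.
        (\<forall>i. i \<notin> {1..k} \<longrightarrow> c i = 0) \<and> x = (\<Sum>i=1..k. of_int (c i) *\<^sub>R e i)"
    using assms(1,2) unfolding int_basis_def by blast
  moreover have "(\<forall>i. i \<notin> {1..k} \<longrightarrow> r c i = 0) \<and> x = (\<Sum>i=1..k. of_int (r c i) *\<^sub>R e i)"
    unfolding eq using assms(3) by (auto simp: r_def)
  moreover have "(\<forall>i. i \<notin> {1..k} \<longrightarrow> r d i = 0) \<and> x = (\<Sum>i=1..k. of_int (r d i) *\<^sub>R e i)"
    unfolding eq using assms(4) by (auto simp: r_def)
  ultimately have "r c = r d" by blast
  then show ?thesis using assms(5) unfolding r_def by metis
qed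

lemma int_basis_subset_int_combs:
  assumes "int_basis k e L"
  shows "L \<subseteq> int_combs k e"
proof
  fix x assume "x \<in> L"
  then have "\<exists>c :: nat \<Rightarrow> int. x = (\<Sum>i=1..k. of_int (c i) *\<^sub>R e i)"
    using assms unfolding int_basis_def by blast
  then show "x \<in> int_combs k e" unfolding int_combs_def by blast
qed

text \<open>A generating family of at most \<open>dim L\<close> vectors is linearly independent, even over the reals.\<close>

lemma int_basisI:
  fixes e :: "nat \<Rightarrow> real ^ 'n"
  assumes "e ` {1..k} \<subseteq> L" and "L \<subseteq> int_combs k e" and "k \<le> dim L"
  shows "int_basis k e L"
  unfolding int_basis_def
proof (intro conjI ballI)
  have sp: "L \<subseteq> span (e ` {1..k})"
    using assms(2) int_combs_subset_span by blast
  have card: "card (e ` {1..k}) \<le> k"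
    using card_image_le[of "{1..k}" e] by simp
  have ind: "independent (e ` {1..k})"
    by (rule card_le_dim_spanning[OF assms(1) sp]) (use card assms(3) in auto)
  \<comment> \<open>A spanning set of \<open>L\<close> has at least \<open>k\<close> elements, so
    the \<open>e i\<close> are distinct. Hence a relation indexed by numbers can be reindexed, via
    \<open>inv_into\<close>, as a relation over the independent set of vectors.\<close>
  have "dim L \<le> card (e ` {1..k})"
    by (rule span_card_ge_dim[OF assms(1) sp]) simp
  then have "card (e ` {1..k}) = card {1..k}" using card assms(3) by simp
  then have inj: "inj_on e {1..k}" by (intro eq_card_imp_inj_on) auto
  have zero: "c i = 0" if "(\<Sum>i=1..k. of_int (c i) *\<^sub>R e i) = 0" "i \<in> {1..k}" for c :: "nat \<Rightarrow> int" and i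
  proof -
    have "(\<Sum>x\<in>e ` {1..k}. of_int (c (inv_into {1..k} e x)) *\<^sub>R x) = 0"
      unfolding sum.reindex[OF inj] that(1)[symmetric]
      by (rule sum.cong) (simp_all add: inv_into_f_f[OF inj] del: One_nat_def)
    moreover have "e i \<in> e ` {1..k}" using that(2) by blast
    ultimately have "of_int (c (inv_into {1..k} e (e i))) = (0::real)"
      using independentD[OF ind, of "e ` {1..k}" "\<lambda>x. of_int (c (inv_into {1..k} e x))"] by simp
    then show ?thesis using inv_into_f_f[OF inj that(2)] by simp
  qed
  fix x assume "x \<in> L"
  then obtain c :: "nat \<Rightarrow> int" where c: "x = (\<Sum>i=1..k. of_int (c i) *\<^sub>R e i)"
    using assms(2) unfolding int_combs_def by blast
  show "\<exists>!c :: nat \<Rightarrow> int.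
      (\<forall>i. i \<notin> {1..k} \<longrightarrow> c i = 0) \<and> x = (\<Sum>i=1..k. of_int (c i) *\<^sub>R e i)"
  proof (rule ex1I)
    show "(\<forall>i. i \<notin> {1..k} \<longrightarrow> (if i \<in> {1..k} then c i else 0) = 0) \<and>
        x = (\<Sum>i=1..k. of_int (if i \<in> {1..k} then c i else 0) *\<^sub>R e i)"
      unfolding c by (auto intro: sum.cong)
  next
    fix d :: "nat \<Rightarrow> int"
    assume d: "(\<forall>i. i \<notin> {1..k} \<longrightarrow> d i = 0) \<and> x = (\<Sum>i=1..k. of_int (d i) *\<^sub>R e i)"
    then have "(\<Sum>i=1..k. of_int (c i - d i) *\<^sub>R e i) = 0"
      using c by (simp add: scaleR_diff_left sum_subtractf)
    then have "c i = d i" if "i \<in> {1..k}" for i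
      using zero[of "\<lambda>i. c i - d i"] that by simp
    then show "d = (\<lambda>i. if i \<in> {1..k} then c i else 0)"
      using d by auto
  qed
qed (use assms(1) in auto)

section \<open>Uniqueness of the Hermite basis\<close>

text \<open>Comparing coordinates of the \<open>i\<close>-th edge vector in both bases shows that the diagonal entries
  divide each other, and then the bounds on the other entries leave no freedom for \<open>e i\<close>.\<close>

lemma hermite_basis_step:
  fixes \<gamma> :: "'n::finite ordered_cone"
  assumes "hermite_basis \<gamma> e a" and "hermite_basis \<gamma> e' a'" and "i \<in> {1..cone_dim \<gamma>}"
    and "\<And>j. j \<in> {1..<i} \<Longrightarrow> e' j = e j"
  obtains c :: "nat \<Rightarrow> int"
  where "e' i = (\<Sum>j=1..cone_dim \<gamma>. of_int (c j) *\<^sub>R e j)"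
    and "\<And>j. j \<in> {i<..cone_dim \<gamma>} \<Longrightarrow> c j = 0"
    and "a i i = a' i i * c i"
    and "\<And>j. j \<in> {1..<i} \<Longrightarrow> a j i - a' j i = a' i i * c j"
proof -
  let ?k = "cone_dim \<gamma>" and ?L = "cone_lattice \<gamma>"
  have b: "int_basis ?k e ?L" "int_basis ?k e' ?L"
    using assms(1,2) by (auto simp: hermite_basis_def)
  have e'i: "e' i \<in> ?L" using b(2) assms(3) by (auto simp: int_basis_def)
  then obtain c :: "nat \<Rightarrow> int" where c: "e' i = (\<Sum>j=1..?k. of_int (c j) *\<^sub>R e j)"
    using int_basis_subset_int_combs[OF b(1)] unfolding int_combs_def by blast
  have pos: "a' i i > 0" using assms(2,3) by (auto simp: hermite_basis_def)
  have split: "(\<Sum>j=1..i. f j) = (\<Sum>j\<in>{1..<i}. f j) + f i" for f :: "nat \<Rightarrow> real ^ 'n"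
    using assms(3) by (simp add: sum.last_plus add.commute)
  have "edge_vec \<gamma> i = (\<Sum>j\<in>{1..<i}. of_int (a' j i) *\<^sub>R e' j) + of_int (a' i i) *\<^sub>R e' i"
    using assms(2,3) unfolding hermite_basis_def by (simp only: split)
  also have "(\<Sum>j\<in>{1..<i}. of_int (a' j i) *\<^sub>R e' j) = (\<Sum>j\<in>{1..<i}. of_int (a' j i) *\<^sub>R e j)"
    using assms(4) by (intro sum.cong) auto
  finally have 1: "edge_vec \<gamma> i =
      (\<Sum>j\<in>{1..<i}. of_int (a' j i) *\<^sub>R e j) + of_int (a' i i) *\<^sub>R e' i" .
  have 2: "edge_vec \<gamma> i = (\<Sum>j\<in>{1..<i}. of_int (a j i) *\<^sub>R e j) + of_int (a i i) *\<^sub>R e i"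
    using assms(1,3) unfolding hermite_basis_def by (simp only: split)
  \<comment> \<open>The coordinates of \<open>a' i i\<close> times \<open>e' i\<close> with respect
    to \<open>e\<close>, obtained by equating the expansions 1 and 2 of the edge vector. They vanish
    beyond \<open>i\<close>, as these expansions stop at \<open>i\<close>.\<close>
  define d where "d = (\<lambda>j. if j < i then a j i - a' j i else if j = i then a i i else 0)"
  have "of_int (a' i i) *\<^sub>R e' i =
      (\<Sum>j\<in>{1..<i}. of_int (a j i - a' j i) *\<^sub>R e j) + of_int (a i i) *\<^sub>R e i"
    using 1 2 by (simp add: sum_subtractf algebra_simps)
  also have "\<dots> = (\<Sum>j=1..i. of_int (d j) *\<^sub>R e j)"
    unfolding split by (simp add: d_def)
  also have "\<dots> = (\<Sum>j=1..?k. of_int (d j) *\<^sub>R e j)"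
    using assms(3) by (intro sum.mono_neutral_left) (auto simp: d_def)
  finally have d: "of_int (a' i i) *\<^sub>R e' i = (\<Sum>j=1..?k. of_int (d j) *\<^sub>R e j)" .
  have c': "of_int (a' i i) *\<^sub>R e' i = (\<Sum>j=1..?k. of_int (a' i i * c j) *\<^sub>R e j)"
    unfolding c by (simp add: scaleR_sum_right)
  have "of_int (a' i i) *\<^sub>R e' i \<in> ?L"
    using e'i by (auto simp: cone_lattice_def intro: int_vecs_scale span_scale)
  then have eq: "a' i i * c j = d j" if "j \<in> {1..?k}" for j
    using int_basisD[OF b(1) _ c' d that] by simp
  show thesis
  proof (rule that[OF c])
    show "c j = 0" if "j \<in> {i<..?k}" for j
      using eq[of j] that pos assms(3) by (auto simp: d_def)
    show "a i i = a' i i * c i"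
      using eq[of i] assms(3) by (simp add: d_def)
    show "a j i - a' j i = a' i i * c j" if "j \<in> {1..<i}" for j
      using eq[of j] assms(3) that by (simp add: d_def)
  qed
qed

text \<open>Strong induction on \<open>i\<close>, because the preceding step requires equal basis
  vectors at all smaller indices. The step is applied in both directions.\<close>

lemma hermite_basis_unique:
  assumes h: "hermite_basis \<gamma> e a" and h': "hermite_basis \<gamma> e' a'" and "i \<in> {1..cone_dim \<gamma>}"
  shows "e' i = e i \<and> (\<forall>j\<in>{1..i}. a' j i = a j i)"
  using assms(3)
proof (induction i rule: less_induct)
  case (less i)
  let ?k = "cone_dim \<gamma>"
  have IH: "e' j = e j" if "j \<in> {1..<i}" for j
    using less.IH[of j] less.prems that by auto
  obtain c where c: "e' i = (\<Sum>j=1..?k. of_int (c j) *\<^sub>R e j)"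
      "\<And>j. j \<in> {i<..?k} \<Longrightarrow> c j = 0" "a i i = a' i i * c i"
      "\<And>j. j \<in> {1..<i} \<Longrightarrow> a j i - a' j i = a' i i * c j"
    by (rule hermite_basis_step[OF h h' less.prems]) (use IH in auto)
  obtain c' where c': "a' i i = a i i * c' i"
    by (rule hermite_basis_step[OF h' h less.prems]) (use IH in auto)
  have pos: "a i i > 0" "a' i i > 0"
    using h h' less.prems by (auto simp: hermite_basis_def)
  have "a i i = a' i i"
  proof (rule zdvd_antisym_nonneg)
    show "a i i dvd a' i i" using c' by (rule dvdI)
    show "a' i i dvd a i i" using c(3) by (rule dvdI)
  qed (use pos in auto)
  then have "c i = 1" using c(3) pos by simp
  \<comment> \<open>Both entries lie between \<open>0\<close> and the common diagonal entry, so
    their difference, a multiple of that entry, is \<open>0\<close>.\<close>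
  have small: "a' j i = a j i \<and> c j = 0" if j: "j \<in> {1..<i}" for j
  proof -
    have "0 \<le> a j i \<and> a j i < a i i" "0 \<le> a' j i \<and> a' j i < a' i i"
      using h h' less.prems j unfolding hermite_basis_def by blast+
    then have "\<bar>a' i i * c j\<bar> < a' i i"
      using c(4)[OF j] \<open>a i i = a' i i\<close> by linarith
    then have "a' i i * \<bar>c j\<bar> < a' i i * 1" using pos by (simp add: abs_mult)
    then have "c j = 0" using pos by (subst (asm) mult_less_cancel_left_pos) auto
    then show ?thesis using c(4)[OF j] by simp
  qed
  have "c j = (if j = i then 1 else 0)" if "j \<in> {1..?k}" for j
    using small[of j] c(2)[of j] \<open>c i = 1\<close> that less.prems by (cases j i rule: linorder_cases) auto
  then have "e' i = (\<Sum>j=1..?k. of_int (if j = i then 1 else 0) *\<^sub>R e j)"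
    unfolding c(1) by (intro sum.cong) auto
  also have "\<dots> = e i"
    using less.prems by (simp add: if_distrib[of of_int] if_distrib[of "\<lambda>r. r *\<^sub>R _"] cong: if_cong)
  finally have "e' i = e i" .
  moreover have "a' j i = a j i" if "j \<in> {1..i}" for j
    using that small[of j] \<open>a i i = a' i i\<close> by (cases "j = i") auto
  ultimately show ?case by blast
qed

text \<open>By uniqueness, exhibiting one Hermite basis is enough to compute sines and
  cosines.\<close>

lemma hermite_entry_eq:
  assumes "hermite_basis \<gamma> e a" and "1 \<le> j" and "j \<le> i" and "i \<le> cone_dim \<gamma>"
  shows "hermite_entry j i \<gamma> = a j i"
  unfolding hermite_entry_def
proof (rule the_equality)
  show "\<exists>e' a'. hermite_basis \<gamma> e' a' \<and> a j i = a' j i" using assms(1) by blast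
next
  fix c assume "\<exists>e' a'. hermite_basis \<gamma> e' a' \<and> c = a' j i"
  then obtain e' a' where "hermite_basis \<gamma> e' a'" "c = a' j i" by blast
  then show "c = a j i"
    using hermite_basis_unique[OF assms(1), of e' a' i] assms(2-4) by auto
qed

section \<open>The last column of the Hermite matrix\<close>

text \<open>The first \<open>m\<close> edge vectors already belong to the basis, so the Hermite
  matrix is the identity outside its last column, and adjusting the last basis vector alone
  normalises that column. This serves both cones.\<close>

lemma lsin_lcos_last:
  fixes \<gamma> :: "'n::finite ordered_cone"
  assumes dim: "cone_dim \<gamma> = Suc m"
    and e: "e ` {1..Suc m} \<subseteq> cone_lattice \<gamma>" "cone_lattice \<gamma> \<subseteq> int_combs (Suc m) e"
      "Suc m \<le> dim (cone_lattice \<gamma>)"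
    and edge: "\<And>i. i \<in> {1..m} \<Longrightarrow> edge_vec \<gamma> i = e i"
    and last: "edge_vec \<gamma> (Suc m) = (\<Sum>j=1..m. of_int (c j) *\<^sub>R e j) + of_int s *\<^sub>R e (Suc m)"
    and s: "0 < s"
  shows "lsin (Suc m) \<gamma> = s" and "\<And>j. j \<in> {1..m} \<Longrightarrow> lcos j (Suc m) \<gamma> = c j mod s"
proof -
  \<comment> \<open>Adding \<open>p\<close> to \<open>e (Suc m)\<close> absorbs the quotients:
    \<open>s\<close> times the new vector contains \<open>s * (c j div s)\<close> of each
    \<open>e j\<close>, which leaves the coefficient \<open>c j mod s\<close>.\<close>
  define p where "p = (\<Sum>j=1..m. of_int (c j div s) *\<^sub>R e j)"
  define e' where "e' = e(Suc m := e (Suc m) + p)"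
  define a where "a = (\<lambda>j i. if i = Suc m then if j = Suc m then s else c j mod s
      else if j = i then 1 else 0)"
  have e'_le: "e' i = e i" if "i \<in> {1..m}" for i
    using that by (simp add: e'_def)
  have "p \<in> int_combs m e" unfolding p_def by (rule int_combsI)
  then have p: "p \<in> cone_lattice \<gamma>" "p \<in> int_combs (Suc m) e'"
  proof -
    have "e ` {1..m} \<subseteq> cone_lattice \<gamma>" using e(1) by auto
    then show "p \<in> int_combs m e \<Longrightarrow> p \<in> cone_lattice \<gamma>"
      using int_combs_subset_lattice unfolding cone_lattice_def by blast
    have "e i \<in> int_combs (Suc m) e'" if "i \<in> {1..m}" for i
      using int_combs_base[of i "Suc m" e'] that by (simp add: e'_le)
    then show "p \<in> int_combs m e \<Longrightarrow> p \<in> int_combs (Suc m) e'"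
      using int_combs_subset[of m e "Suc m" e'] by blast
  qed
  have "e' i \<in> cone_lattice \<gamma>" if "i \<in> {1..Suc m}" for i
  proof -
    have "e i \<in> cone_lattice \<gamma>" using e(1) that by blast
    then show ?thesis
      using p(1) by (auto simp: e'_def cone_lattice_def intro: int_vecs_add span_add)
  qed
  moreover have "cone_lattice \<gamma> \<subseteq> int_combs (Suc m) e'"
  proof -
    have "e i \<in> int_combs (Suc m) e'" if i: "i \<in> {1..Suc m}" for i
    proof (cases "i = Suc m")
      case True
      then have "e i = e' i - p" by (simp add: e'_def)
      then show ?thesis using int_combs_base[OF i, of e'] p(2) by (simp add: int_combs_diff)
    next
      case False
      then show ?thesis using int_combs_base[OF i, of e'] by (simp add: e'_def)
    qed
    then show ?thesis using e(2) int_combs_subset by blast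
  qed
  ultimately have basis: "int_basis (Suc m) e' (cone_lattice \<gamma>)"
    using e(3) by (intro int_basisI) auto
  have "hermite_basis \<gamma> e' a"
    unfolding hermite_basis_def dim
  proof (intro conjI ballI basis)
    fix i assume i: "i \<in> {1..Suc m}"
    show "edge_vec \<gamma> i = (\<Sum>j=1..i. of_int (a j i) *\<^sub>R e' j)"
    proof (cases "i = Suc m")
      case True
      have "(\<Sum>j=1..m. of_int (a j i) *\<^sub>R e' j) + of_int s *\<^sub>R p
          = (\<Sum>j=1..m. of_int (c j mod s) *\<^sub>R e j + of_int (s * (c j div s)) *\<^sub>R e j)"
        unfolding p_def sum.distrib scaleR_sum_right
        by (intro arg_cong2[of _ _ _ _ "(+)"] sum.cong) (auto simp: a_def True e'_le)
      also have "\<dots> = (\<Sum>j=1..m. of_int (c j) *\<^sub>R e j)"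
        by (simp only: scaleR_add_left[symmetric] of_int_add[symmetric] mod_mult_div_eq)
      finally have "(\<Sum>j=1..m. of_int (a j i) *\<^sub>R e' j) + of_int s *\<^sub>R p
          = (\<Sum>j=1..m. of_int (c j) *\<^sub>R e j)" .
      then show ?thesis
        by (simp add: True last a_def e'_def algebra_simps)
    next
      case False
      then have "(\<Sum>j=1..i. of_int (a j i) *\<^sub>R e' j) = (\<Sum>j=1..i. if j = i then e' j else 0)"
        by (intro sum.cong) (auto simp: a_def)
      then show ?thesis using i False by (simp add: edge e'_le)
    qed
    show "0 < a i i" using s by (simp add: a_def)
    fix j assume "j \<in> {1..<i}"
    then show "0 \<le> a j i" "a j i < a i i"
      using i s by (auto simp: a_def)
  qed
  from hermite_entry_eq[OF this]
  show "lsin (Suc m) \<gamma> = s" and "\<And>j. j \<in> {1..m} \<Longrightarrow> lcos j (Suc m) \<gamma> = c j mod s"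
    by (auto simp: lsin_def lcos_def dim a_def)
qed

section \<open>Extending a basis of a face to a basis of the lattice\<close>

text \<open>The functional \<open>\<phi>\<close> reads off the last coordinate. Modulo \<open>v 1, \<dots>, v m\<close> every lattice vector
  with given \<open>\<phi>\<close>-value has a bounded representative, so \<open>\<phi>\<close> has a least positive value on the
  lattice; any \<open>u\<close> attaining it works.\<close>

lemma extend_int_basis:
  fixes v :: "nat \<Rightarrow> real ^ 'n" and m :: nat
  defines "L \<equiv> int_vecs \<inter> span (v ` {1..Suc m})"
  assumes inj: "inj_on v {1..Suc m}" and ind: "independent (v ` {1..Suc m})"
    and int: "v ` {1..Suc m} \<subseteq> int_vecs"
    and face: "int_vecs \<inter> span (v ` {1..m}) \<subseteq> int_combs m v"
  obtains u c s where "u \<in> L" and "0 < (s::int)"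
    and "v (Suc m) = (\<Sum>j=1..m. of_int (c j) *\<^sub>R v j) + of_int s *\<^sub>R u"
    and "L \<subseteq> int_combs (Suc m) (v(Suc m := u))"
proof -
  have set: "v ` {1..Suc m} = insert (v (Suc m)) (v ` {1..m})"
    by (auto simp: atLeastAtMostSuc_conv)
  have vm: "v (Suc m) \<notin> v ` {1..m}"
    using inj by (force simp: inj_on_def)
  obtain \<phi> :: "real ^ 'n \<Rightarrow> real" where lin: "linear \<phi>"
    and \<phi>: "\<forall>x\<in>v ` {1..Suc m}. \<phi> x = (if x = v (Suc m) then 1 else 0)"
    using linear_independent_extend[OF ind, of "\<lambda>x. if x = v (Suc m) then 1 else 0"] by blast
  have \<phi>1: "\<phi> (v (Suc m)) = 1" using \<phi> by auto
  have \<phi>0: "\<phi> x = 0" if "x \<in> span (v ` {1..m})" for x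
  proof (rule linear_eq_0_on_span[OF lin _ that])
    fix y assume "y \<in> v ` {1..m}"
    then have "y \<noteq> v (Suc m)" "y \<in> v ` {1..Suc m}" using vm set by blast+
    then show "\<phi> y = 0" using \<phi> by metis
  qed
  have ker: "x - \<phi> x *\<^sub>R v (Suc m) \<in> span (v ` {1..m})" if x: "x \<in> L" for x
  proof -
    obtain t where t: "x - t *\<^sub>R v (Suc m) \<in> span (v ` {1..m})"
      using x unfolding L_def set by (auto simp: span_breakdown_eq)
    then have "\<phi> x = t"
      using \<phi>0[OF t] \<phi>1 lin by (simp add: linear_diff linear_scale)
    with t show ?thesis by simp
  qed
  have vL: "v i \<in> L" if "i \<in> {1..Suc m}" for i
    using that int by (auto simp: L_def intro: span_base)
  have L_diff: "x - of_int q *\<^sub>R y \<in> L" if "x \<in> L" "y \<in> L" for x y q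
    using that by (auto simp: L_def intro: int_vecs_diff int_vecs_scale span_diff span_scale)
  \<comment> \<open>Bounds a representative whose coefficients are fractional parts on
    \<open>v 1, ..., v m\<close> and \<open>\<phi> x\<close>, at most \<open>1\<close>, on
    \<open>v (Suc m)\<close>.\<close>
  define R where "R = (\<Sum>j=1..Suc m. norm (v j))"
  have red: "\<exists>y\<in>{y. y \<in> int_vecs \<and> norm y \<le> R}. \<phi> y = \<phi> x" if x: "x \<in> L" "0 < \<phi> x" "\<phi> x \<le> 1" for x
  proof -
    have "span (v ` {1..m}) = range (\<lambda>t. \<Sum>w\<in>v ` {1..m}. t w *\<^sub>R w)"
      by (rule span_finite) simp
    then obtain t where "x - \<phi> x *\<^sub>R v (Suc m) = (\<Sum>w\<in>v ` {1..m}. t w *\<^sub>R w)"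
      using ker[OF x(1)] by blast
    also have "\<dots> = (\<Sum>j=1..m. t (v j) *\<^sub>R v j)"
      using inj by (subst sum.reindex) (auto intro: inj_on_subset)
    finally have t: "x = (\<Sum>j=1..m. t (v j) *\<^sub>R v j) + \<phi> x *\<^sub>R v (Suc m)"
      by (simp add: algebra_simps)
    \<comment> \<open>The integer part of \<open>x\<close> along the face. It lies in the kernel of
      \<open>\<phi>\<close>, so subtracting it preserves the value.\<close>
    define z where "z = (\<Sum>j=1..m. of_int \<lfloor>t (v j)\<rfloor> *\<^sub>R v j)"
    have "v ` {1..m} \<subseteq> int_vecs \<inter> span (v ` {1..m})"
      using int by (auto intro: span_base)
    then have "z \<in> int_vecs \<inter> span (v ` {1..m})"
      using int_combs_subset_lattice[of v m] int_combsI[of "\<lambda>j. \<lfloor>t (v j)\<rfloor>" v m] z_def by blast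
    then have z: "z \<in> int_vecs" "z \<in> span (v ` {1..m})" by auto
    have "x - z = (\<Sum>j=1..m. frac (t (v j)) *\<^sub>R v j) + \<phi> x *\<^sub>R v (Suc m)"
      by (subst t) (simp add: z_def frac_def scaleR_diff_left sum_subtractf)
    also have "norm \<dots> \<le> (\<Sum>j=1..m. norm (frac (t (v j)) *\<^sub>R v j)) + norm (\<phi> x *\<^sub>R v (Suc m))"
      by (intro norm_triangle_mono norm_sum order_refl)
    also have "\<dots> \<le> (\<Sum>j=1..m. norm (v j)) + norm (v (Suc m))"
    proof (intro add_mono sum_mono)
      show "norm (frac (t (v j)) *\<^sub>R v j) \<le> norm (v j)" for j
        using mult_right_mono[of "frac (t (v j))" 1 "norm (v j)"]
        by (simp add: frac_lt_1 less_imp_le)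
      show "norm (\<phi> x *\<^sub>R v (Suc m)) \<le> norm (v (Suc m))"
        using mult_right_mono[of "\<phi> x" 1 "norm (v (Suc m))"] x by simp
    qed
    finally have "norm (x - z) \<le> R" by (simp add: R_def)
    moreover have "x - z \<in> int_vecs" using x(1) z(1) by (auto simp: L_def intro: int_vecs_diff)
    moreover have "\<phi> (x - z) = \<phi> x" using \<phi>0[OF z(2)] lin by (simp add: linear_diff)
    ultimately show ?thesis by blast
  qed
  \<comment> \<open>Restricting to values at most \<open>1\<close> gives a finite set, and loses no
    minimum because \<open>v (Suc m)\<close> has the value \<open>1\<close>.\<close>
  define D where "D = \<phi> ` {x \<in> L. 0 < \<phi> x \<and> \<phi> x \<le> 1}"
  have "D \<subseteq> \<phi> ` {y. y \<in> int_vecs \<and> norm y \<le> R}"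
    using red unfolding D_def by (force simp: image_iff)
  then have fin: "finite D"
    using finite_bounded_int_vecs finite_subset by blast
  have "1 \<in> D"
    unfolding D_def using vL[of "Suc m"] \<phi>1 by (intro image_eqI[of _ _ "v (Suc m)"]) auto
  then have "Min D \<in> D" using fin by (intro Min_in) auto
  then obtain u where u: "u \<in> L" "0 < \<phi> u" "\<phi> u = Min D" by (auto simp: D_def)
  have min: "\<phi> u \<le> \<phi> x" if "x \<in> L" "0 < \<phi> x" for x
  proof (cases "\<phi> x \<le> 1")
    case True
    then show ?thesis using that fin by (auto simp: u(3) D_def intro: Min_le)
  next
    case False
    then show ?thesis using fin \<open>1 \<in> D\<close> Min_le[of D 1] u(3) by linarith
  qed
  \<comment> \<open>Division with remainder by \<open>\<phi> u\<close>: the remainder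
    \<open>y\<close> has a value below the least positive one, hence \<open>0\<close>, so it lies in
    the lattice of the face, where \<open>face\<close> applies.\<close>
  have mult: "\<exists>q::int. \<phi> x = of_int q * \<phi> u \<and> x - of_int q *\<^sub>R u \<in> int_combs m v" if x: "x \<in> L" for x
  proof -
    define q where "q = \<lfloor>\<phi> x / \<phi> u\<rfloor>"
    define y where "y = x - of_int q *\<^sub>R u"
    have y: "y \<in> L" unfolding y_def using x u(1) by (rule L_diff)
    have \<phi>y: "\<phi> y = \<phi> x - of_int q * \<phi> u"
      using lin by (simp add: y_def linear_diff linear_scale)
    have "of_int q \<le> \<phi> x / \<phi> u" "\<phi> x / \<phi> u < of_int q + 1"
      unfolding q_def by linarith+
    then have "0 \<le> \<phi> y" "\<phi> y < \<phi> u"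
      unfolding \<phi>y using u(2) by (simp_all add: field_simps)
    then have "\<phi> y = 0" using min[OF y] by linarith
    then have "y \<in> int_vecs \<inter> span (v ` {1..m})"
      using ker[OF y] y by (simp add: L_def)
    then show ?thesis using face \<phi>y \<open>\<phi> y = 0\<close> y_def by auto
  qed
  \<comment> \<open>Dividing \<open>v (Suc m)\<close>, of value \<open>1\<close>, shows that
    \<open>s\<close> is the reciprocal of \<open>\<phi> u\<close>; this gives both its integrality
    and its sign.\<close>
  obtain s where s: "1 = of_int s * \<phi> u" "v (Suc m) - of_int s *\<^sub>R u \<in> int_combs m v"
    using mult[OF vL[of "Suc m"]] \<phi>1 by auto
  from s(2) obtain c where c: "v (Suc m) - of_int s *\<^sub>R u = (\<Sum>j=1..m. of_int (c j) *\<^sub>R v j)"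
    unfolding int_combs_def by blast
  show thesis
  proof (rule that[OF u(1)])
    have "0 < of_int s * \<phi> u" using s(1) by simp
    then show "0 < s" using u(2) by (simp add: zero_less_mult_iff)
    show "v (Suc m) = (\<Sum>j=1..m. of_int (c j) *\<^sub>R v j) + of_int s *\<^sub>R u"
      using c by (simp add: algebra_simps)
    show "L \<subseteq> int_combs (Suc m) (v(Suc m := u))" (is "_ \<subseteq> int_combs _ ?e")
    proof
      fix x assume "x \<in> L"
      then obtain q where q: "x - of_int q *\<^sub>R u \<in> int_combs m v" using mult by blast
      have "v i \<in> int_combs (Suc m) ?e" if "i \<in> {1..m}" for i
        using int_combs_base[of i "Suc m" ?e] that by auto
      then have "x - of_int q *\<^sub>R u \<in> int_combs (Suc m) ?e"
        using q int_combs_subset[of m v "Suc m" ?e] by blast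
      moreover have "of_int q *\<^sub>R u \<in> int_combs (Suc m) ?e"
        using int_combs_base[of "Suc m" "Suc m" ?e] by (auto intro: int_combs_scale)
      ultimately show "x \<in> int_combs (Suc m) ?e"
        using int_combs_add by fastforce
    qed
  qed
qed

section \<open>Edge vectors and first face of a cone\<close>

lemma edge_vec_angle_cone:
  assumes "i \<in> {1..length Bs}"
    and "Bs ! (i - 1) - B \<in> int_vecs" and "Bs ! (i - 1) \<noteq> B" and "int_length B (Bs ! (i - 1)) = 1"
  shows "edge_vec (angle_cone B Bs) i = Bs ! (i - 1) - B"
proof -
  have "edges (angle_cone B Bs) ! (i - 1) = ray B (Bs ! (i - 1))"
    using assms(1) by (auto simp: angle_cone_def)
  then show ?thesis
    using edge_vec_eq[of "angle_cone B Bs" i "Bs ! (i - 1)"] assms(2-4) by (simp add: angle_cone_def)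
qed

text \<open>The face omitting the last edge has integer sine 1, so its edge vectors generate its
  lattice. They are those of \<open>\<gamma>\<close>, since an edge vector depends only on the
  vertex and its ray.\<close>

lemma first_face_saturated:
  fixes \<gamma> :: "'n::finite ordered_cone"
  assumes "simple_cone \<gamma>" and "cone_dim \<gamma> = Suc m"
  shows "int_vecs \<inter> span (edge_vec \<gamma> ` {1..m}) \<subseteq> int_combs m (edge_vec \<gamma>)"
proof -
  define \<delta> where "\<delta> = Cone (vertex \<gamma>) (take m (edges \<gamma>))"
  have "\<forall>I \<subseteq> {..<Suc m}. card I = m \<longrightarrow> cone_lsin (Cone (vertex \<gamma>) (nths (edges \<gamma>) I)) = 1"
    using assms by (simp add: simple_cone_def)
  \<comment> \<open>List positions start at 0, so this set selects the edges numbered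
    \<open>1\<close> to \<open>m\<close>.\<close>
  moreover have "{..<m} \<subseteq> {..<Suc m}" "card {..<m} = m" by auto
  ultimately have "cone_lsin (Cone (vertex \<gamma>) (nths (edges \<gamma>) {..<m})) = 1" by blast
  then have 1: "cone_lsin \<delta> = 1" by (simp add: \<delta>_def)
  have dim: "cone_dim \<delta> = m"
    using assms(2) by (simp add: \<delta>_def cone_dim_def)
  have edge: "edge_vec \<delta> i = edge_vec \<gamma> i" if "i \<in> {1..m}" for i
  proof -
    have "take m (edges \<gamma>) ! (i - 1) = edges \<gamma> ! (i - 1)"
      using that by (intro nth_take) auto
    then show ?thesis by (simp add: \<delta>_def edge_vec_def)
  qed
  have "cone_lattice \<delta> \<subseteq> int_combs m (edge_vec \<delta>)"
    using 1 unfolding cone_lsin_def dim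
    by (rule subgroup_index_eq_1_imp_subset) (auto simp: cone_lattice_def span_zero int_combs_0)
  moreover have "cone_lattice \<delta> = int_vecs \<inter> span (edge_vec \<gamma> ` {1..m})"
    unfolding cone_lattice_def dim using edge by (simp cong: image_cong_simp)
  moreover have "int_combs m (edge_vec \<delta>) \<subseteq> int_combs m (edge_vec \<gamma>)"
    using edge int_combs_base[of _ m "edge_vec \<gamma>"] by (intro int_combs_subset) auto
  ultimately show ?thesis by blast
qed

section \<open>Comparison of the cones at two vertices of the simplex\<close>

theorem proposition3p19:
  fixes A :: "nat \<Rightarrow> real ^ 'n" and k :: nat
    and \<alpha> \<beta> :: "'n ordered_cone"
  assumes "k \<ge> 2"
    and "inj_on A {0..k}" and "\<not> affine_dependent (A ` {0..k})"
    and "\<forall>i\<in>{0..k}. A i \<in> int_vecs"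
    and "\<forall>i\<in>{0..k}. \<forall>j\<in>{0..k}. i \<noteq> j \<longrightarrow> int_length (A i) (A j) = 1"
    and "\<alpha> = angle_cone (A 0) (map A [1..<k+1])"
    and "\<beta> = angle_cone (A 1) (A 0 # map A [2..<k+1])"
    and "simple_cone \<alpha>" and "simple_cone \<beta>"
  shows "lsin k \<beta> = lsin k \<alpha> \<and>
    [lcos 1 k \<beta> + (\<Sum>i=1..k-1. lcos i k \<alpha>) = 1] (mod lsin k \<alpha>) \<and>
    (\<forall>x\<in>{2..k-1}. lcos x k \<beta> = lcos x k \<alpha>)"
proof -
  obtain m where k: "k = Suc m" and m: "m \<ge> 1"
    using assms(1) by (cases k) auto
  define v where "v = (\<lambda>i. A i - A 0)"
  have dim: "cone_dim \<alpha> = Suc m" "cone_dim \<beta> = Suc m"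
    using assms(1) by (auto simp: assms(6,7) cone_dim_def angle_cone_def k)
  have diff: "A j - A i \<in> int_vecs" "A j \<noteq> A i" "int_length (A i) (A j) = 1"
    if "i \<le> k" "j \<le> k" "i \<noteq> j" for i j
    using that assms(2,4,5) by (auto intro: int_vecs_diff simp: inj_on_def)
  have \<alpha>: "edge_vec \<alpha> i = v i" if i: "i \<in> {1..Suc m}" for i
  proof -
    have "map A [1..<k+1] ! (i - 1) = A i"
      using i by (subst nth_map) (auto simp: k simp del: upt_Suc)
    then show ?thesis
      using edge_vec_angle_cone[of i "map A [1..<k+1]" "A 0"] diff[of 0 i] i
      by (simp add: assms(6) v_def k del: upt_Suc)
  qed
  have \<beta>1: "edge_vec \<beta> 1 = - v 1"
    using edge_vec_angle_cone[of 1 "A 0 # map A [2..<k+1]" "A 1"] diff[of 1 0] m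
    by (simp add: assms(7) v_def k del: upt_Suc)
  \<comment> \<open>In the list of \<open>\<beta>\<close>, \<open>A 0\<close> stands in the place
    that \<open>A 1\<close> has for \<open>\<alpha>\<close>; from the second place on, edge numbers
    agree with vertex indices.\<close>
  have \<beta>: "edge_vec \<beta> i = v i - v 1" if i: "i \<in> {2..Suc m}" for i
  proof -
    have "(A 0 # map A [2..<k+1]) ! (i - 1) = A i"
      using i by (subst nth_Cons_pos, simp, subst nth_map) (auto simp: k Suc_diff_Suc simp del: upt_Suc)
    then show ?thesis
      using edge_vec_angle_cone[of i "A 0 # map A [2..<k+1]" "A 1"] diff[of 1 i] i
      by (simp add: assms(7) v_def k del: upt_Suc)
  qed
  have inj: "inj_on v {1..Suc m}"
    using assms(2) by (auto simp: v_def inj_on_def k)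
  have ind: "independent (v ` {1..Suc m})"
  proof
    assume "dependent (v ` {1..Suc m})"
    moreover have "v ` {1..Suc m} = {x - A 0 |x. x \<in> A ` {1..Suc m}}"
      by (auto simp: v_def)
    moreover have "A 0 \<notin> A ` {1..Suc m}"
      using assms(2) by (force simp: inj_on_def k)
    ultimately have "affine_dependent (insert (A 0) (A ` {1..Suc m}))"
      by (simp only: dependent_imp_affine_dependent not_False_eq_True)
    moreover have "insert (A 0) (A ` {1..Suc m}) = A ` {0..k}"
    proof -
      have "{0..k} = insert 0 {1..Suc m}" by (auto simp: k)
      then show ?thesis by simp
    qed
    ultimately show False using assms(3) by simp
  qed
  define L where "L = int_vecs \<inter> span (v ` {1..Suc m})"
  have vint: "v ` {1..Suc m} \<subseteq> int_vecs"
    using diff(1)[of 0] by (auto simp: v_def k)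
  then have vL: "v i \<in> L" if "i \<in> {1..Suc m}" for i
    using that by (auto simp: L_def intro: span_base)
  have L_diff: "x - y \<in> L" if "x \<in> L" "y \<in> L" for x y
    using that by (auto simp: L_def intro: int_vecs_diff span_diff)
  have "0 \<in> L" by (simp add: L_def span_zero)
  have L\<alpha>: "cone_lattice \<alpha> = L"
    unfolding cone_lattice_def dim L_def using \<alpha> by (simp cong: image_cong_simp)
  have L\<beta>: "cone_lattice \<beta> = L"
  proof -
    have "edge_vec \<beta> i \<in> span (v ` {1..Suc m})" if "i \<in> {1..Suc m}" for i
    proof -
      have "v 1 \<in> span (v ` {1..Suc m})" "v i \<in> span (v ` {1..Suc m})"
        using that by (auto intro: span_base)
      then show ?thesis
        using that \<beta>1 \<beta>[of i] by (cases "i = 1") (auto intro: span_neg span_diff)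
    qed
    moreover have "v i \<in> span (edge_vec \<beta> ` {1..Suc m})" if "i \<in> {1..Suc m}" for i
    proof -
      have e: "edge_vec \<beta> i \<in> span (edge_vec \<beta> ` {1..Suc m})" if "i \<in> {1..Suc m}" for i
        using that by (auto intro: span_base)
      have "v 1 = - edge_vec \<beta> 1" unfolding \<beta>1 by simp
      moreover have "v i = edge_vec \<beta> i - edge_vec \<beta> 1" if "i \<noteq> 1"
        using that \<open>i \<in> {1..Suc m}\<close> \<beta>[of i] unfolding \<beta>1 by simp
      ultimately show ?thesis
        using e[of 1] e[OF that] by (cases "i = 1") (auto intro: span_neg span_diff)
    qed
    ultimately have "span (edge_vec \<beta> ` {1..Suc m}) = span (v ` {1..Suc m})"
      by (subst span_eq) blast
    then show ?thesis by (simp add: cone_lattice_def dim L_def)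
  qed
  have "int_vecs \<inter> span (v ` {1..m}) \<subseteq> int_combs m v"
  proof -
    have "edge_vec \<alpha> ` {1..m} = v ` {1..m}" using \<alpha> by (intro image_cong) auto
    moreover have "int_combs m (edge_vec \<alpha>) \<subseteq> int_combs m v"
      using \<alpha> int_combs_base[of _ m v] by (intro int_combs_subset) auto
    ultimately show ?thesis
      using first_face_saturated[OF assms(8) dim(1)] by auto
  qed
  then obtain u c s where u: "u \<in> L" and s: "0 < (s::int)"
    and vm: "v (Suc m) = (\<Sum>j=1..m. of_int (c j) *\<^sub>R v j) + of_int s *\<^sub>R u"
    and gen: "L \<subseteq> int_combs (Suc m) (v(Suc m := u))"
    by (rule extend_int_basis[OF inj ind vint, folded L_def])
  \<comment> \<open>This dimension bound is what turns the generating families \<open>e\<close> and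
    \<open>f\<close> below into bases.\<close>
  have dimL: "Suc m \<le> dim L"
  proof -
    have "Suc m = card (v ` {1..Suc m})" using inj by (simp add: card_image)
    also have "\<dots> \<le> dim L"
      using ind vL by (intro independent_card_le_dim) auto
    finally show ?thesis .
  qed
  define e where "e = v(Suc m := u)"
  have "e ` {1..Suc m} \<subseteq> L" using u vL by (auto simp: e_def)
  moreover have "edge_vec \<alpha> (Suc m) = (\<Sum>j=1..m. of_int (c j) *\<^sub>R e j) + of_int s *\<^sub>R e (Suc m)"
    by (simp add: \<alpha> vm e_def)
  ultimately have A: "lsin (Suc m) \<alpha> = s" "\<And>j. j \<in> {1..m} \<Longrightarrow> lcos j (Suc m) \<alpha> = c j mod s"
    using lsin_lcos_last[of \<alpha> m e c s] gen dim(1) dimL s L\<alpha> \<alpha> by (auto simp: e_def)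
  \<comment> \<open>Keeping \<open>u\<close> as the last vector makes \<open>s\<close> the last
    coordinate for both cones, whence the equal sines.\<close>
  define f where "f = (\<lambda>i. if i = Suc m then u else if i = 1 then - v 1 else v i - v 1)"
  \<comment> \<open>Rewriting \<open>c j v j\<close> as \<open>c j (v j - v 1) + c j v 1\<close> for
    \<open>j \<ge> 2\<close> gives \<open>v k - v 1\<close> the coefficient
    \<open>(c 1 + ... + c m) - 1\<close> at \<open>v 1\<close>; the sign flips because the basis
    vector is \<open>- v 1\<close>.\<close>
  define b where "b = c(1 := 1 - (\<Sum>j=1..m. c j))"
  have f\<beta>: "edge_vec \<beta> i = f i" if "i \<in> {1..m}" for i
    using that \<beta>1 \<beta>[of i] by (auto simp: f_def)
  have "f i \<in> L" if "i \<in> {1..Suc m}" for i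
    using that u vL[of i] vL[of 1] L_diff[of 0 "v 1"] \<open>0 \<in> L\<close> m
    by (auto simp: f_def intro: L_diff)
  then have "f ` {1..Suc m} \<subseteq> L" by blast
  moreover have "L \<subseteq> int_combs (Suc m) f"
  proof -
    have fb: "f i \<in> int_combs (Suc m) f" if "i \<in> {1..Suc m}" for i
      using that by (rule int_combs_base)
    have "(v(Suc m := u)) i \<in> int_combs (Suc m) f" if i: "i \<in> {1..Suc m}" for i
    proof -
      consider "i = Suc m" | "i = 1" "i \<noteq> Suc m" | "i \<noteq> 1" "i \<noteq> Suc m" by blast
      then show ?thesis
      proof cases
        case 1
        then show ?thesis using fb[OF i] by (simp add: f_def)
      next
        case 2
        then have "v i = 0 - f 1" by (simp add: f_def)
        then show ?thesis using 2 fb[of 1] int_combs_diff[OF int_combs_0] by auto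
      next
        case 3
        then have "v i = f i - f 1" using m by (simp add: f_def)
        then show ?thesis using 3 fb[of 1] fb[OF i] int_combs_diff by auto
      qed
    qed
    then show ?thesis using gen int_combs_subset by blast
  qed
  moreover have "edge_vec \<beta> (Suc m) = (\<Sum>j=1..m. of_int (b j) *\<^sub>R f j) + of_int s *\<^sub>R f (Suc m)"
  proof -
    have set: "{1..m} = insert 1 {2..m}" using m by auto
    have f: "f j = v j - v 1" if "j \<in> {2..m}" for j using that by (simp add: f_def)
    have f1: "f 1 = - v 1" using m by (simp add: f_def)
    have bj: "b j = c j" if "j \<in> {2..m}" for j using that by (simp add: b_def)
    have "(\<Sum>j=1..m. of_int (b j) *\<^sub>R f j)
        = of_int (b 1) *\<^sub>R f 1 + (\<Sum>j=2..m. of_int (b j) *\<^sub>R f j)"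
      unfolding set by simp
    also have "\<dots> = of_int ((\<Sum>j=1..m. c j) - 1) *\<^sub>R v 1 + (\<Sum>j=2..m. of_int (c j) *\<^sub>R (v j - v 1))"
    proof (rule arg_cong2[of _ _ _ _ "(+)"])
      show "of_int (b 1) *\<^sub>R f 1 = of_int ((\<Sum>j=1..m. c j) - 1) *\<^sub>R v 1"
        unfolding f1 by (simp add: b_def algebra_simps)
    qed (intro sum.cong, auto simp: f bj)
    also have "\<dots> = (\<Sum>j=1..m. of_int (c j) *\<^sub>R v j) - v 1"
      unfolding set by (simp add: algebra_simps sum_subtractf scaleR_sum_left)
    finally show ?thesis
      using \<beta>[of "Suc m"] m by (simp add: vm f_def)
  qed
  ultimately have B: "lsin (Suc m) \<beta> = s" "\<And>j. j \<in> {1..m} \<Longrightarrow> lcos j (Suc m) \<beta> = b j mod s"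
    using lsin_lcos_last[of \<beta> m f b s] dim(2) dimL s L\<beta> f\<beta> by auto
  \<comment> \<open>Replacing residues by the coordinates themselves turns the sum into
    \<open>b 1 + (c 1 + ... + c m)\<close>, which is exactly \<open>1\<close>. From index 2 on,
    \<open>b\<close> and \<open>c\<close> agree, so there the residues are equal.\<close>
  have "[lcos 1 k \<beta> + (\<Sum>i=1..k-1. lcos i k \<alpha>) = b 1 + (\<Sum>i=1..m. c i)] (mod s)"
    using m by (auto simp: k A(2) B(2) intro!: cong_add cong_sum)
  then have "[lcos 1 k \<beta> + (\<Sum>i=1..k-1. lcos i k \<alpha>) = 1] (mod s)"
    by (simp add: b_def)
  then show ?thesis
    using A B by (auto simp: k b_def)
qed

end
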